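(* Let $r\geq 3$ and let $H$ be an $r$-uniform hypergraph with $E(H)\neq\emptyset$. Then there exists a vertex $u$ of $H$ such that $$\rho(H(u))\geq (r-1)\beta(H)$$ and $H$ has $p=\lceil (r-1)\beta(H)\rceil\geq\left\lceil\frac{r(r-1)|E(H)|}{|V(H)|\,\rho(H^{(2)})}\right\rceil$ distinct edges $e_1,\ldots,e_p$ such that $u\in e_1\cap\cdots\cap e_p$ and $$|e_1\cap\cdots\cap e_p|\geq 2.$$
   Context: A (finite) hypergraph $H$ with vertex set $V(H)$ and edge set $E(H)$ is $r$-uniform if each edge consists of exactly $r$ distinct vertices; a graph is a $2$-uniform hypergraph. The adjacency tensor of an $r$-uniform hypergraph $H$ is the $r$-order $|V(H)|$-dimension tensor $\mathcal{A}_H=(a_{i_1\cdots i_r})$ with $a_{i_1\cdots i_r}=\frac{1}{(r-1)!}$ if $\{i_1,\ldots,i_r\}\in E(H)$ and $0$ otherwise. For an $m$-order $n$-dimension tensor $\mathcal{A}=(a_{i_1\cdots i_m})$ and $x\in\mathbb{C}^n$, $\mathcal{A}x^{m-1}\in\mathbb{C}^n$ is the vector with $i$-th component $\sum_{i_2,\ldots,i_m=1}^n a_{ii_2\cdots i_m}x_{i_2}\cdots x_{i_m}$. A number $\lambda\in\mathbb{C}$ is an eigenvalue of $\mathcal{A}$ if $\mathcal{A}x^{m-1}=\lambda x^{[m-1]}$ for some nonzero $x\in\mathbb{C}^n$, where $x^{[m-1]}=(x_1^{m-1},\ldots,x_n^{m-1})^\top$. The spectral radius of $\mathcal{A}$ is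 the largest modulus of its eigenvalues. The spectral radius $\rho(H)$ of a uniform hypergraph $H$ is the spectral radius of $\mathcal{A}_H$ (for a graph, this is the spectral radius of its adjacency matrix). The 2-section graph $H^{(2)}$ of $H$ is the graph on $V(H)$ in which distinct $u,v$ are adjacent if and only if $\{u,v\}\subseteq e$ for some $e\in E(H)$. The spectral radius ratio is $\beta(H)=\rho(H)/\rho(H^{(2)})$. For a vertex $u$ of $H$, $N(u)$ is the set of neighbors of $u$ in $H^{(2)}$, and $H(u)$ is the $(r-1)$-uniform hypergraph with vertex set $N(u)$ and edge set $\{e\setminus\{u\}: u\in e\in E(H)\}$. *)

theory Defs
  imports Complex_Main
begin

record 'a hypergraph =
  hverts :: "'a set"
  hedges :: "'a set set"

definition uniform_hypergraph :: "nat \<Rightarrow> 'a hypergraph \<Rightarrow> bool" where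
  "uniform_hypergraph r H \<longleftrightarrow>
     finite (hverts H) \<and> (\<forall>e\<in>hedges H. e \<subseteq> hverts H \<and> card e = r)"

text \<open>
  A tensor of order \<open>m\<close> whose indices range over a finite set \<open>I\<close> (in place of \<open>{1..n}\<close>) is
  a function on index lists; only its values on lists of length \<open>m\<close> with entries in \<open>I\<close>
  matter. Likewise a vector is a function of which only the values on \<open>I\<close> matter.
\<close>

type_synonym 'a tensor = "'a list \<Rightarrow> complex"

definition tensor_apply :: "'a set \<Rightarrow> nat \<Rightarrow> 'a tensor \<Rightarrow> ('a \<Rightarrow> complex) \<Rightarrow> 'a \<Rightarrow> complex" where
  "tensor_apply I m A x i =
     (\<Sum>js | set js \<subseteq> I \<and> length js = m - 1. A (i # js) * prod_list (map x js))"

definition tensor_eigenvalue :: "'a set \<Rightarrow> nat \<Rightarrow> 'a tensor \<Rightarrow> complex \<Rightarrow> bool" where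
  "tensor_eigenvalue I m A l \<longleftrightarrow>
     (\<exists>x. (\<exists>i\<in>I. x i \<noteq> 0) \<and> (\<forall>i\<in>I. tensor_apply I m A x i = l * x i ^ (m - 1)))"

definition tensor_spectral_radius :: "'a set \<Rightarrow> nat \<Rightarrow> 'a tensor \<Rightarrow> real" where
  "tensor_spectral_radius I m A = (GREATEST s. \<exists>l. tensor_eigenvalue I m A l \<and> s = cmod l)"

definition adjacency_tensor :: "nat \<Rightarrow> 'a hypergraph \<Rightarrow> 'a tensor" where
  "adjacency_tensor r H is = (if set is \<in> hedges H then 1 / fact (r - 1) else 0)"

text \<open>
  The uniformity \<open>r\<close> is an explicit argument because a hypergraph without edges does not
  determine it.
\<close>

definition spectral_radius :: "nat \<Rightarrow> 'a hypergraph \<Rightarrow> real" where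
  "spectral_radius r H = tensor_spectral_radius (hverts H) r (adjacency_tensor r H)"

definition two_section :: "'a hypergraph \<Rightarrow> 'a hypergraph" where
  "two_section H =
     \<lparr>hverts = hverts H, hedges = {{u, v} | u v. u \<noteq> v \<and> (\<exists>e\<in>hedges H. {u, v} \<subseteq> e)}\<rparr>"

definition spectral_radius_ratio :: "nat \<Rightarrow> 'a hypergraph \<Rightarrow> real" where
  "spectral_radius_ratio r H = spectral_radius r H / spectral_radius 2 (two_section H)"

definition neighbors :: "'a hypergraph \<Rightarrow> 'a \<Rightarrow> 'a set" where
  "neighbors H u = {v. {u, v} \<in> hedges (two_section H)}"

definition link :: "'a hypergraph \<Rightarrow> 'a \<Rightarrow> 'a hypergraph" where
  "link H u = \<lparr>hverts = neighbors H u, hedges = {e - {u} | e. e \<in> hedges H \<and> u \<in> e}\<rparr>"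

lemma uniform_two_section:
  assumes "uniform_hypergraph r H"
  shows "uniform_hypergraph 2 (two_section H)"
  using assms unfolding uniform_hypergraph_def two_section_def by fastforce

lemma neighbors_iff: "v \<in> neighbors H u \<longleftrightarrow> u \<noteq> v \<and> (\<exists>e\<in>hedges H. {u, v} \<subseteq> e)"
  unfolding neighbors_def two_section_def by (auto simp: doubleton_eq_iff)

lemma uniform_link:
  assumes "uniform_hypergraph r H"
  shows "uniform_hypergraph (r - 1) (link H u)"
proof -
  have "neighbors H u \<subseteq> hverts H"
    using assms unfolding uniform_hypergraph_def by (auto simp: neighbors_iff; blast)
  then have "finite (neighbors H u)"
    using assms by (auto simp: uniform_hypergraph_def intro: finite_subset)
  then show ?thesis
    using assms unfolding uniform_hypergraph_def link_def by (auto simp: neighbors_iff)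
qed

end

theory Submission
  imports Defs "HOL-Analysis.Function_Topology" "HOL-Combinatorics.Multiset_Permutations"
begin

text \<open>
  The spectral radius of an \<open>r\<close>-uniform hypergraph is the maximum of
  \<open>r \<Sum>\<^sub>e \<Prod>\<^sub>j\<^sub>\<in>\<^sub>e x\<^sub>j\<close> over \<open>x \<ge> 0\<close> with \<open>\<Sum> x\<^sub>i\<^sup>r = 1\<close>, attained at an eigenvector \<open>x\<close>.
  The eigenequation at \<open>u\<close> evaluates the form of the link \<open>H(u)\<close> at \<open>x\<close>. Hence \<open>y = x\<^bsup>r-1\<^esup>\<close> satisfies
  \<open>(r - 1) \<rho>(H) y\<^sub>u \<le> \<rho>(H(u)) \<Sum>\<^sub>v y\<^sub>v\<close>, where \<open>v\<close> ranges over the neighbors of \<open>u\<close>; pairing this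
  with \<open>y\<close> in the 2-section shows that \<open>\<rho>(H(u)) < (r - 1) \<beta>(H)\<close> cannot hold for all \<open>u\<close>. The edges
  \<open>e\<^sub>i\<close> are then those through \<open>u\<close> and a vertex of \<open>H(u)\<close> whose degree is at least \<open>\<rho>(H(u))\<close>.
\<close>

section \<open>The edge polynomial, its gradient, links and the 2-section\<close>

text \<open>The Lagrangian polynomial of \<open>H\<close>. For an \<open>r\<close>-uniform
  \<open>H\<close>, multiplying it by \<open>r\<close> gives the homogeneous form of the adjacency
  tensor.\<close>

definition edge_form :: "'a hypergraph \<Rightarrow> ('a \<Rightarrow> 'b::comm_semiring_1) \<Rightarrow> 'b" where
  "edge_form H x = (\<Sum>e\<in>hedges H. \<Prod>j\<in>e. x j)"

text \<open>The partial derivative of \<open>edge_form H\<close> in coordinate \<open>i\<close>,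
  written combinatorially. The semiring type lets one definition serve complex eigenvectors and real
  test vectors.\<close>

definition edge_grad :: "'a hypergraph \<Rightarrow> ('a \<Rightarrow> 'b::comm_semiring_1) \<Rightarrow> 'a \<Rightarrow> 'b" where
  "edge_grad H x i = (\<Sum>e\<in>{e\<in>hedges H. i \<in> e}. \<Prod>j\<in>e - {i}. x j)"

text \<open>The triangle inequality; it allows a complex eigenvector to be replaced by the vector of
  its moduli.\<close>

lemma norm_edge_grad_le:
  fixes x :: "'a \<Rightarrow> complex"
  shows "cmod (edge_grad H x i) \<le> edge_grad H (\<lambda>j. cmod (x j)) i"
  unfolding edge_grad_def by (rule order_trans[OF norm_sum]) (simp add: prod_norm)

lemma edge_grad_of_real:
  "edge_grad H (\<lambda>j. complex_of_real (x j)) i = complex_of_real (edge_grad H x i)"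
  by (simp add: edge_grad_def)

lemma edge_grad_eq_edge_form_link: "edge_grad H x u = edge_form (link H u) x"
proof -
  have "hedges (link H u) = (\<lambda>e. e - {u}) ` {e\<in>hedges H. u \<in> e}"
    by (auto simp: link_def)
  moreover have "inj_on (\<lambda>e. e - {u}) {e\<in>hedges H. u \<in> e}"
    by (auto simp: inj_on_def)
  ultimately show ?thesis
    by (simp add: edge_grad_def edge_form_def sum.reindex)
qed

text \<open>For a graph the gradient is the adjacency matrix applied to \<open>y\<close>: the edges
  through \<open>u\<close> correspond to its neighbors.\<close>

lemma edge_grad_two_section:
  fixes y :: "'a \<Rightarrow> 'b::comm_semiring_1"
  shows "edge_grad (two_section H) y u = (\<Sum>v\<in>neighbors H u. y v)"
proof -
  have "{e\<in>hedges (two_section H). u \<in> e} = (\<lambda>v. {u, v}) ` neighbors H u"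
    by (auto simp: neighbors_def two_section_def insert_commute)
  moreover have "inj_on (\<lambda>v. {u, v}) (neighbors H u)"
    by (auto simp: inj_on_def doubleton_eq_iff)
  moreover have "{u, v} - {u} = {v}" if "v \<in> neighbors H u" for v
    using that by (auto simp: neighbors_iff)
  ultimately show ?thesis by (simp add: edge_grad_def sum.reindex)
qed

text \<open>Turns a vertex of large degree in the link into many edges of \<open>H\<close> sharing
  two vertices. Deleting \<open>u\<close> is injective on the edges through
  \<open>u\<close>.\<close>

lemma edges_of_link:
  assumes "v \<in> neighbors H u"
  shows "card {f\<in>hedges (link H u). v \<in> f} = card {e\<in>hedges H. u \<in> e \<and> v \<in> e}"
proof -
  have "{f\<in>hedges (link H u). v \<in> f} = (\<lambda>e. e - {u}) ` {e\<in>hedges H. u \<in> e \<and> v \<in> e}"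
    using assms by (auto simp: link_def neighbors_iff)
  moreover have "inj_on (\<lambda>e. e - {u}) {e\<in>hedges H. u \<in> e \<and> v \<in> e}"
    by (auto simp: inj_on_def)
  ultimately show ?thesis by (simp add: card_image)
qed

section \<open>The adjacency tensor of a uniform hypergraph and its edge polynomial\<close>

context
  fixes r :: nat and H :: "'a hypergraph"
  assumes uniform: "uniform_hypergraph r H"
begin

lemma finite_hverts: "finite (hverts H)"
  using uniform by (simp add: uniform_hypergraph_def)

lemma hedge_subset: "e \<in> hedges H \<Longrightarrow> e \<subseteq> hverts H"
  using uniform by (simp add: uniform_hypergraph_def)

lemma card_hedge: "e \<in> hedges H \<Longrightarrow> card e = r"
  using uniform by (simp add: uniform_hypergraph_def)

lemma finite_hedges: "finite (hedges H)"
  using hedge_subset finite_hverts by (meson PowI finite_Pow_iff finite_subset subsetI)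

lemma finite_hedge: "e \<in> hedges H \<Longrightarrow> finite e"
  using hedge_subset finite_hverts finite_subset by blast

text \<open>The nonzero entries come from the orderings of \<open>e - {i}\<close> for edges
  \<open>e\<close> through \<open>i\<close>. Each edge has \<open>fact (r - 1)\<close> of them,
  which cancels the weight in the tensor.\<close>

lemma tensor_apply_adjacency:
  assumes "r \<ge> 1"
  shows "tensor_apply (hverts H) r (adjacency_tensor r H) x i = edge_grad H x i"
proof -
  define J where "J = {js. set js \<subseteq> hverts H \<and> length js = r - 1}"
  define F where "F = (\<lambda>js. adjacency_tensor r H (i # js) * prod_list (map x js))"
  let ?D = "{e\<in>hedges H. i \<in> e}"
  have finJ: "finite J"
    unfolding J_def using finite_lists_length_eq[OF finite_hverts] by simp
  \<comment> \<open>A list of length \<open>r - 1\<close> that together with \<open>i\<close> covers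
    an edge of size \<open>r\<close> has no room to repeat an entry or to contain
    \<open>i\<close>.\<close>
  have perm: "js \<in> permutations_of_set (e - {i}) \<longleftrightarrow> js \<in> J \<and> insert i (set js) = e"
    if e: "e \<in> ?D" for e js
  proof
    assume "js \<in> permutations_of_set (e - {i})"
    then have "set js = e - {i}" "distinct js"
      by (auto simp: permutations_of_set_def)
    then show "js \<in> J \<and> insert i (set js) = e"
      using e card_hedge[of e] hedge_subset[of e] distinct_card[of js]
      by (auto simp: J_def)
  next
    assume js: "js \<in> J \<and> insert i (set js) = e"
    then have "card (insert i (set js)) = r" "length js = r - 1"
      using e card_hedge by (auto simp: J_def)
    then have "i \<notin> set js \<and> card (set js) = length js"
      using card_length[of js] assms by (cases "i \<in> set js") (auto simp: insert_absorb)
    then show "js \<in> permutations_of_set (e - {i})"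
      using js by (auto simp: permutations_of_set_def intro: card_distinct)
  qed
  have "tensor_apply (hverts H) r (adjacency_tensor r H) x i = sum F J"
    by (simp add: tensor_apply_def J_def F_def)
  also have "\<dots> = sum F (\<Union>e\<in>?D. permutations_of_set (e - {i}))"
  proof (rule sum.mono_neutral_right[OF finJ])
    show "(\<Union>e\<in>?D. permutations_of_set (e - {i})) \<subseteq> J"
      using perm by blast
    show "\<forall>js\<in>J - (\<Union>e\<in>?D. permutations_of_set (e - {i})). F js = 0"
    proof
      fix js assume js: "js \<in> J - (\<Union>e\<in>?D. permutations_of_set (e - {i}))"
      have "insert i (set js) \<notin> hedges H"
      proof
        assume "insert i (set js) \<in> hedges H"
        then have "insert i (set js) \<in> ?D" by simp
        then show False using perm[of "insert i (set js)" js] js by blast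
      qed
      then show "F js = 0" by (simp add: F_def adjacency_tensor_def)
    qed
  qed
  also have "\<dots> = (\<Sum>e\<in>?D. sum F (permutations_of_set (e - {i})))"
  proof (rule sum.UNION_disjoint)
    \<comment> \<open>The list determines its edge, as \<open>insert i (set js)\<close>.\<close>
    show "\<forall>e\<in>?D. \<forall>e'\<in>?D. e \<noteq> e' \<longrightarrow>
        permutations_of_set (e - {i}) \<inter> permutations_of_set (e' - {i}) = {}"
      using perm by blast
  qed (use finite_hedges in auto)
  also have "\<dots> = edge_grad H x i"
    unfolding edge_grad_def
  proof (rule sum.cong[OF refl])
    fix e assume e: "e \<in> ?D"
    have "F js = (\<Prod>j\<in>e - {i}. x j) / fact (r - 1)"
      if js: "js \<in> permutations_of_set (e - {i})" for js
    proof -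
      have "insert i (set js) \<in> hedges H" using perm[OF e] js e by auto
      moreover have "prod_list (map x js) = (\<Prod>j\<in>e - {i}. x j)"
        using js prod.distinct_set_conv_list[of js x] by (auto simp: permutations_of_set_def)
      ultimately show ?thesis by (simp add: F_def adjacency_tensor_def)
    qed
    then have "sum F (permutations_of_set (e - {i})) =
        of_nat (card (permutations_of_set (e - {i}))) * ((\<Prod>j\<in>e - {i}. x j) / fact (r - 1))"
      by simp
    moreover have "card (permutations_of_set (e - {i})) = fact (r - 1)"
      using e finite_hedge[of e] card_hedge[of e] by simp
    ultimately show "sum F (permutations_of_set (e - {i})) = (\<Prod>j\<in>e - {i}. x j)"
      by simp
  qed
  finally show ?thesis .
qed

lemma tensor_eigenvalue_adjacency:
  assumes "r \<ge> 1"
  shows "tensor_eigenvalue (hverts H) r (adjacency_tensor r H) l \<longleftrightarrow>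
    (\<exists>x. (\<exists>i\<in>hverts H. x i \<noteq> 0) \<and> (\<forall>i\<in>hverts H. edge_grad H x i = l * x i ^ (r - 1)))"
  by (simp add: tensor_eigenvalue_def tensor_apply_adjacency[OF assms])

text \<open>Euler's identity for a homogeneous polynomial of degree \<open>r\<close>, by double
  counting the incidences of vertices and edges.\<close>

lemma sum_mult_edge_grad:
  fixes x :: "'a \<Rightarrow> 'b::comm_semiring_1"
  shows "(\<Sum>i\<in>hverts H. x i * edge_grad H x i) = of_nat r * edge_form H x"
proof -
  have "(\<Sum>i\<in>hverts H. x i * edge_grad H x i)
      = (\<Sum>i\<in>hverts H. \<Sum>e\<in>{e\<in>hedges H. i \<in> e}. \<Prod>j\<in>e. x j)"
    unfolding edge_grad_def sum_distrib_left
    by (intro sum.cong refl) (auto simp: prod.remove finite_hedge)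
  also have "\<dots> = (\<Sum>e\<in>hedges H. \<Sum>i\<in>{i\<in>hverts H. i \<in> e}. \<Prod>j\<in>e. x j)"
    by (rule sum.swap_restrict[OF finite_hverts finite_hedges])
  also have "\<dots> = (\<Sum>e\<in>hedges H. of_nat r * (\<Prod>j\<in>e. x j))"
  proof (rule sum.cong[OF refl])
    fix e assume e: "e \<in> hedges H"
    then have "{i\<in>hverts H. i \<in> e} = e" using hedge_subset by blast
    then show "(\<Sum>i\<in>{i\<in>hverts H. i \<in> e}. \<Prod>j\<in>e. x j) = of_nat r * (\<Prod>j\<in>e. x j)"
      using card_hedge[OF e] by simp
  qed
  finally show ?thesis by (simp add: edge_form_def sum_distrib_left)
qed

text \<open>A first-order expansion without remainder: edges are sets, so \<open>x i\<close> occurs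
  at most once in each monomial.\<close>

lemma edge_form_update:
  fixes x :: "'a \<Rightarrow> 'b::comm_ring_1"
  shows "edge_form H (x(i := x i + t)) = edge_form H x + t * edge_grad H x i"
proof -
  have "(\<Prod>j\<in>e. (x(i := x i + t)) j) =
      (\<Prod>j\<in>e. x j) + (if i \<in> e then t * (\<Prod>j\<in>e - {i}. x j) else 0)"
    if e: "e \<in> hedges H" for e
  proof (cases "i \<in> e")
    case True
    have "(\<Prod>j\<in>e - {i}. (x(i := x i + t)) j) = (\<Prod>j\<in>e - {i}. x j)"
      by (rule prod.cong) auto
    then show ?thesis
      using True finite_hedge[OF e] by (simp add: prod.remove algebra_simps)
  next
    case False
    then have "(\<Prod>j\<in>e. (x(i := x i + t)) j) = (\<Prod>j\<in>e. x j)"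
      by (intro prod.cong) auto
    then show ?thesis using False by simp
  qed
  then have "edge_form H (x(i := x i + t)) =
      (\<Sum>e\<in>hedges H. (\<Prod>j\<in>e. x j) + (if i \<in> e then t * (\<Prod>j\<in>e - {i}. x j) else 0))"
    unfolding edge_form_def by (rule sum.cong[OF refl])
  then show ?thesis
    by (simp add: sum.distrib edge_form_def edge_grad_def sum_distrib_left
        sum.inter_filter[OF finite_hedges, symmetric])
qed

lemma edge_form_nonneg:
  fixes x :: "'a \<Rightarrow> real"
  assumes "\<And>i. i \<in> hverts H \<Longrightarrow> x i \<ge> 0"
  shows "edge_form H x \<ge> 0"
  unfolding edge_form_def using assms hedge_subset by (intro sum_nonneg prod_nonneg) blast

lemma edge_grad_nonneg:
  fixes x :: "'a \<Rightarrow> real"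
  assumes "\<And>i. i \<in> hverts H \<Longrightarrow> x i \<ge> 0"
  shows "edge_grad H x i \<ge> 0"
  unfolding edge_grad_def using assms hedge_subset by (intro sum_nonneg prod_nonneg) blast

lemma edge_form_scale: "edge_form H (\<lambda>i. c * x i) = c ^ r * edge_form H x"
  unfolding edge_form_def sum_distrib_left
  by (intro sum.cong refl) (simp add: prod.distrib card_hedge)

lemma edge_form_cong:
  "(\<And>i. i \<in> hverts H \<Longrightarrow> x i = y i) \<Longrightarrow> edge_form H x = edge_form H y"
  unfolding edge_form_def using hedge_subset by (intro sum.cong prod.cong refl) blast

section \<open>The variational characterisation of the spectral radius\<close>

text \<open>A continuous function attains its maximum on the compact set of nonnegative vectors with
  power sum 1; homogeneity of degree \<open>r\<close> then carries the bound to every nonnegative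
  \<open>y\<close>.\<close>

lemma edge_form_maximiser:
  assumes "r \<ge> 1" and "hverts H \<noteq> {}"
  obtains x :: "'a \<Rightarrow> real" where "\<And>i. x i \<ge> 0" "(\<Sum>i\<in>hverts H. x i ^ r) = 1"
    "\<forall>y. (\<forall>i\<in>hverts H. y i \<ge> 0) \<longrightarrow>
       edge_form H y \<le> edge_form H x * (\<Sum>i\<in>hverts H. y i ^ r)"
proof -
  \<comment> \<open>Vectors are functions on the whole type, so coordinates outside
    \<open>hverts H\<close> are confined to the unit interval too; Tychonoff's theorem then gives
    compactness.\<close>
  define K :: "('a \<Rightarrow> real) set"
    where "K = {x. \<forall>i. x i \<in> {0..1}} \<inter> {x. (\<Sum>i\<in>hverts H. x i ^ r) = 1}"
  have "compactin (product_topology (\<lambda>i::'a. euclideanreal) UNIV) (PiE UNIV (\<lambda>i. {0..1}))"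
    by (simp add: compactin_PiE)
  moreover have "PiE UNIV (\<lambda>i::'a. {0..1::real}) = {x. \<forall>i. x i \<in> {0..1}}"
    by (auto simp: PiE_def)
  ultimately have "compact {x::'a \<Rightarrow> real. \<forall>i. x i \<in> {0..1}}"
    by (simp add: euclidean_product_topology)
  moreover have "closed {x::'a \<Rightarrow> real. (\<Sum>i\<in>hverts H. x i ^ r) = 1}"
    by (intro closed_Collect_eq continuous_intros continuous_on_product_coordinates)
  ultimately have "compact K"
    unfolding K_def by (rule compact_Int_closed)
  moreover obtain v where v: "v \<in> hverts H" using assms by blast
  have "(\<lambda>i. if i = v then 1 else 0) \<in> K"
  proof -
    have "(\<Sum>i\<in>hverts H. (if i = v then 1 else 0) ^ r) = (\<Sum>i\<in>hverts H. if i = v then 1 else (0::real))"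
      using assms by (intro sum.cong) auto
    then show ?thesis using v finite_hverts by (simp add: K_def)
  qed
  then have "K \<noteq> {}" by blast
  moreover have "continuous_on K (edge_form H)"
    unfolding edge_form_def
    by (intro continuous_intros continuous_on_subset[OF continuous_on_product_coordinates]) auto
  ultimately obtain x where x: "x \<in> K" and max: "\<And>y. y \<in> K \<Longrightarrow> edge_form H y \<le> edge_form H x"
    using continuous_attains_sup by metis
  have le: "edge_form H y \<le> edge_form H x * (\<Sum>i\<in>hverts H. y i ^ r)"
    if nonneg: "\<And>i. i \<in> hverts H \<Longrightarrow> y i \<ge> 0" for y
  proof -
    define s where "s = (\<Sum>i\<in>hverts H. y i ^ r)"
    have s0: "s \<ge> 0" unfolding s_def using nonneg by (intro sum_nonneg) auto
    show ?thesis
    proof (cases "s = 0")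
      case True
      then have "\<forall>i\<in>hverts H. y i ^ r = 0"
        unfolding s_def using nonneg by (subst (asm) sum_nonneg_eq_0_iff) (auto simp: finite_hverts)
      then have "edge_form H y = edge_form H (\<lambda>i. 0 * y i)"
        by (intro edge_form_cong) auto
      also have "\<dots> = 0" using assms edge_form_scale[of 0 y] by simp
      finally show ?thesis using True by (simp add: s_def)
    next
      case False
      then have spos: "s > 0" using s0 by simp
      define c where "c = root r s"
      have c: "c > 0" "c ^ r = s"
        using spos assms by (auto simp: c_def)
      \<comment> \<open>Normalised to power sum 1, and set to 0 off the vertices so that
        \<open>z\<close> lies in \<open>K\<close>; the edge polynomial does not see those
        values.\<close>
      define z where "z = (\<lambda>i. if i \<in> hverts H then y i / c else 0)"
      have sum1: "(\<Sum>i\<in>hverts H. z i ^ r) = 1"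
        using spos by (simp add: z_def power_divide c flip: sum_divide_distrib s_def)
      have "z i \<in> {0..1}" for i
      proof (cases "i \<in> hverts H")
        case True
        have zn: "z j \<ge> 0" for j using nonneg c by (simp add: z_def)
        then have "z i ^ r \<le> (\<Sum>i\<in>hverts H. z i ^ r)"
          using True by (intro member_le_sum) (auto simp: finite_hverts)
        then have "z i ^ r \<le> 1 ^ r" using sum1 by simp
        then have "z i \<le> 1"
          using assms zn power_le_imp_le_base[of "z i" "r - 1" 1] by simp
        then show ?thesis using zn by simp
      qed (simp add: z_def)
      then have "z \<in> K" using sum1 by (simp add: K_def)
      moreover have "edge_form H y = edge_form H (\<lambda>i. c * z i)"
        using c by (intro edge_form_cong) (simp add: z_def)
      then have "edge_form H y = s * edge_form H z" by (simp add: edge_form_scale c)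
      ultimately show ?thesis
        using max[of z] spos by (simp add: mult.commute flip: s_def)
    qed
  qed
  show ?thesis
    using that[of x] x le by (auto simp: K_def)
qed

text \<open>At a maximiser, stationarity is elementary because \<open>edge_form\<close> is affine in each
  coordinate; coordinates equal to \<open>0\<close> need only one-sided perturbations.\<close>

lemma edge_form_maximiser_eigenvector:
  fixes x :: "'a \<Rightarrow> real"
  assumes "r \<ge> 2" and nonneg: "\<And>i. x i \<ge> 0" and sum1: "(\<Sum>i\<in>hverts H. x i ^ r) = 1"
    and max: "\<forall>y. (\<forall>i\<in>hverts H. y i \<ge> 0) \<longrightarrow>
       edge_form H y \<le> edge_form H x * (\<Sum>i\<in>hverts H. y i ^ r)"
    and i: "i \<in> hverts H"
  shows "edge_grad H x i = real r * edge_form H x * x i ^ (r - 1)"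
proof -
  define \<mu> where "\<mu> = edge_form H x"
  define g where "g = edge_grad H x i"
  have mu0: "\<mu> \<ge> 0" and g0: "g \<ge> 0"
    using nonneg by (auto simp: \<mu>_def g_def intro: edge_form_nonneg edge_grad_nonneg)
  \<comment> \<open>Maximality is tested on \<open>x\<close> with coordinate \<open>i\<close> moved
    by \<open>t\<close>, which changes the power sum from 1 to
    \<open>1 + (x i + t) ^ r - x i ^ r\<close>.\<close>
  have key: "t * g \<le> \<mu> * ((x i + t) ^ r - x i ^ r)" if t: "x i + t \<ge> 0" for t
  proof -
    have "\<mu> + t * g \<le> \<mu> * (\<Sum>j\<in>hverts H. (x(i := x i + t)) j ^ r)"
      using max[rule_format, of "x(i := x i + t)"] t nonneg by (simp add: edge_form_update \<mu>_def g_def)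
    also have "(\<Sum>j\<in>hverts H. (x(i := x i + t)) j ^ r)
        = (x i + t) ^ r + (\<Sum>j\<in>hverts H - {i}. (x(i := x i + t)) j ^ r)"
      using i finite_hverts by (simp add: sum.remove)
    also have "(\<Sum>j\<in>hverts H - {i}. (x(i := x i + t)) j ^ r) = (\<Sum>j\<in>hverts H - {i}. x j ^ r)"
      by (rule sum.cong) auto
    also have "\<dots> = 1 - x i ^ r"
      using sum1 i finite_hverts by (simp add: sum_diff1)
    finally show ?thesis by (simp add: algebra_simps)
  qed
  show ?thesis
  proof (cases "x i = 0")
    case True
    have "g = 0"
    proof (rule ccontr)
      assume "g \<noteq> 0"
      then have gpos: "g > 0" using g0 by simp
      \<comment> \<open>As \<open>r \<ge> 2\<close>, the right side of \<open>key\<close> is of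
        order \<open>t ^ 2\<close> and cannot dominate \<open>t * g\<close>. The bound 1 gives
        \<open>t ^ r \<le> t ^ 2\<close>; the other gives \<open>\<mu> * t < g\<close>, with
        \<open>+ 1\<close> covering \<open>\<mu> = 0\<close>.\<close>
      define t where "t = min 1 (g / (\<mu> + 1))"
      have t: "t > 0" "t \<le> 1" "t \<le> g / (\<mu> + 1)" using gpos mu0 by (auto simp: t_def)
      have "t * g \<le> \<mu> * t ^ r" using key[of t] t True assms(1) by (simp add: power_0_left)
      also have "\<mu> * t ^ r \<le> \<mu> * t ^ 2"
        using t mu0 assms(1) by (intro mult_left_mono power_decreasing) auto
      finally have "t * g \<le> t * (\<mu> * t)" by (simp add: power2_eq_square algebra_simps)
      then have "g \<le> \<mu> * t" using t by simp
      also have "\<dots> \<le> \<mu> * (g / (\<mu> + 1))" using t mu0 by (intro mult_left_mono)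
      finally show False using gpos mu0 by (simp add: field_simps)
    qed
    then show ?thesis using True assms(1) by (simp add: g_def)
  next
    case False
    then have xpos: "x i > 0" using nonneg[of i] by simp
    \<comment> \<open>By \<open>key\<close>, \<open>h\<close> has a local minimum at 0; the radius
      \<open>x i\<close> keeps the moved coordinate nonnegative.\<close>
    define h where "h = (\<lambda>t. \<mu> * (x i + t) ^ r - t * g)"
    have "(h has_real_derivative \<mu> * (real r * x i ^ (r - 1)) - g) (at 0)"
      unfolding h_def by (auto intro!: derivative_eq_intros)
    moreover have "\<forall>t. \<bar>0 - t\<bar> < x i \<longrightarrow> h 0 \<le> h t"
      using key by (auto simp: h_def algebra_simps)
    ultimately have "\<mu> * (real r * x i ^ (r - 1)) - g = 0"
      using DERIV_local_min xpos by blast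
    then show ?thesis by (simp add: g_def \<mu>_def mult_ac)
  qed
qed

text \<open>Stationarity makes \<open>r\<close> times the maximum an eigenvalue. No eigenvalue has
  larger modulus: its eigenvector's moduli form a test vector for the maximum. Hence the greatest
  modulus exists and equals this value.\<close>

lemma Perron_Frobenius:
  assumes "r \<ge> 2" and "hverts H \<noteq> {}"
  obtains x :: "'a \<Rightarrow> real" where "\<And>i. x i \<ge> 0" "\<exists>i\<in>hverts H. x i \<noteq> 0"
    "\<And>i. i \<in> hverts H \<Longrightarrow> edge_grad H x i = spectral_radius r H * x i ^ (r - 1)"
    "\<And>y. (\<And>i. i \<in> hverts H \<Longrightarrow> y i \<ge> 0) \<Longrightarrow>
       real r * edge_form H y \<le> spectral_radius r H * (\<Sum>i\<in>hverts H. y i ^ r)"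
proof -
  have r1: "r \<ge> 1" using assms by simp
  obtain x :: "'a \<Rightarrow> real" where x: "\<And>i. x i \<ge> 0" "(\<Sum>i\<in>hverts H. x i ^ r) = 1"
    and max: "\<forall>y. (\<forall>i\<in>hverts H. y i \<ge> 0) \<longrightarrow>
       edge_form H y \<le> edge_form H x * (\<Sum>i\<in>hverts H. y i ^ r)"
    by (rule edge_form_maximiser[OF r1 assms(2)]) (rule that)
  define \<rho> where "\<rho> = real r * edge_form H x"
  have rho0: "\<rho> \<ge> 0" unfolding \<rho>_def using x edge_form_nonneg by simp
  have eig: "edge_grad H x i = \<rho> * x i ^ (r - 1)" if "i \<in> hverts H" for i
    unfolding \<rho>_def using edge_form_maximiser_eigenvector[OF assms(1) x max that] .
  have bound: "real r * edge_form H y \<le> \<rho> * (\<Sum>i\<in>hverts H. y i ^ r)"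
    if "\<And>i. i \<in> hverts H \<Longrightarrow> y i \<ge> 0" for y
    using mult_left_mono[OF max[rule_format, OF that], where c = "real r"] by (simp add: \<rho>_def mult.assoc)
  have nz: "\<exists>i\<in>hverts H. x i \<noteq> 0"
  proof (rule ccontr)
    assume "\<not> ?thesis"
    then have "(\<Sum>i\<in>hverts H. x i ^ r) = 0" using assms by simp
    then show False using x by simp
  qed
  have "spectral_radius r H = \<rho>"
    unfolding spectral_radius_def tensor_spectral_radius_def tensor_eigenvalue_adjacency[OF r1]
  proof (rule Greatest_equality)
    show "\<exists>l. (\<exists>z. (\<exists>i\<in>hverts H. z i \<noteq> 0) \<and>
        (\<forall>i\<in>hverts H. edge_grad H z i = l * z i ^ (r - 1))) \<and> \<rho> = cmod l"
    proof (intro exI conjI)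
      show "\<exists>i\<in>hverts H. complex_of_real (x i) \<noteq> 0" using nz by simp
      show "\<forall>i\<in>hverts H. edge_grad H (\<lambda>i. complex_of_real (x i)) i
          = complex_of_real \<rho> * complex_of_real (x i) ^ (r - 1)"
        by (simp add: edge_grad_of_real eig)
      show "\<rho> = cmod (complex_of_real \<rho>)" using rho0 by simp
    qed
  next
    fix s
    assume "\<exists>l. (\<exists>z. (\<exists>i\<in>hverts H. z i \<noteq> 0) \<and>
        (\<forall>i\<in>hverts H. edge_grad H z i = l * z i ^ (r - 1))) \<and> s = cmod l"
    then obtain l z where s: "s = cmod l" and z: "\<exists>i\<in>hverts H. z i \<noteq> 0"
      and zl: "\<And>i. i \<in> hverts H \<Longrightarrow> edge_grad H z i = l * z i ^ (r - 1)"
      by blast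
    define y where "y = (\<lambda>i. cmod (z i))"
    \<comment> \<open>The eigenequation in moduli, multiplied by \<open>y i\<close> so that Euler's
      identity turns the sum over \<open>i\<close> into the edge polynomial.\<close>
    have "s * y i ^ r \<le> y i * edge_grad H y i" if i: "i \<in> hverts H" for i
    proof -
      have "s * y i ^ (r - 1) \<le> edge_grad H y i"
        using norm_edge_grad_le[of H z i] zl[OF i] by (simp add: s y_def norm_mult norm_power)
      then have "y i * (s * y i ^ (r - 1)) \<le> y i * edge_grad H y i"
        by (rule mult_left_mono) (simp add: y_def)
      moreover have "y i ^ r = y i * y i ^ (r - 1)"
        using r1 by (cases r) auto
      ultimately show ?thesis by (simp add: algebra_simps)
    qed
    then have "s * (\<Sum>i\<in>hverts H. y i ^ r) \<le> real r * edge_form H y"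
      unfolding sum_distrib_left sum_mult_edge_grad[symmetric] by (rule sum_mono)
    also have "\<dots> \<le> \<rho> * (\<Sum>i\<in>hverts H. y i ^ r)"
      by (rule bound) (simp add: y_def)
    finally have le: "s * (\<Sum>i\<in>hverts H. y i ^ r) \<le> \<rho> * (\<Sum>i\<in>hverts H. y i ^ r)" .
    obtain k where k: "k \<in> hverts H" "z k \<noteq> 0" using z by blast
    have "(\<Sum>i\<in>hverts H. y i ^ r) > 0"
      using k by (intro sum_pos2[OF finite_hverts, of k]) (auto simp: y_def)
    then show "s \<le> \<rho>" using le by simp
  qed
  then show ?thesis using that[of x] x nz eig bound by simp
qed

lemma edge_form_le_spectral_radius:
  fixes y :: "'a \<Rightarrow> real"
  assumes "r \<ge> 2" and "hverts H \<noteq> {}" and nonneg: "\<And>i. i \<in> hverts H \<Longrightarrow> y i \<ge> 0"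
  shows "real r * edge_form H y \<le> spectral_radius r H * (\<Sum>i\<in>hverts H. y i ^ r)"
proof (rule Perron_Frobenius[OF assms(1,2)])
  assume "\<And>y. (\<And>i. i \<in> hverts H \<Longrightarrow> y i \<ge> 0) \<Longrightarrow>
       real r * edge_form H y \<le> spectral_radius r H * (\<Sum>i\<in>hverts H. y i ^ r)"
  from this[OF nonneg] show ?thesis .
qed

section \<open>Degree bounds on the spectral radius\<close>

text \<open>The variational bound at the all-ones vector.\<close>

lemma average_degree_le_spectral_radius:
  assumes "r \<ge> 2" and "hverts H \<noteq> {}"
  shows "real r * real (card (hedges H)) \<le> spectral_radius r H * real (card (hverts H))"
  using edge_form_le_spectral_radius[OF assms, of "\<lambda>_. 1"] by (simp add: edge_form_def)

lemma spectral_radius_pos: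
  assumes "r \<ge> 2" and "hedges H \<noteq> {}"
  shows "spectral_radius r H > 0"
proof -
  obtain e where e: "e \<in> hedges H" using assms by blast
  then have V: "hverts H \<noteq> {}" using hedge_subset[OF e] card_hedge[OF e] assms(1) by auto
  have "real r * real (card (hedges H)) > 0"
    using assms finite_hedges by (simp add: card_gt_0_iff)
  then have "spectral_radius r H * real (card (hverts H)) > 0"
    using average_degree_le_spectral_radius[OF assms(1) V] by linarith
  then show ?thesis by (simp add: zero_less_mult_iff)
qed

text \<open>At a vertex where a nonnegative eigenvector is largest, every edge contributes at most
  \<open>x v ^ (r - 1)\<close> to the eigenequation.\<close>

lemma spectral_radius_le_degree:
  assumes "r \<ge> 2" and "hverts H \<noteq> {}"
  obtains v where "v \<in> hverts H" "spectral_radius r H \<le> real (card {e\<in>hedges H. v \<in> e})"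
proof -
  obtain x :: "'a \<Rightarrow> real" where x: "\<And>i. x i \<ge> 0" "\<exists>i\<in>hverts H. x i \<noteq> 0"
    and eig: "\<And>i. i \<in> hverts H \<Longrightarrow> edge_grad H x i = spectral_radius r H * x i ^ (r - 1)"
    by (rule Perron_Frobenius[OF assms]) (rule that)
  obtain v where v: "v \<in> hverts H" and vmax: "\<And>i. i \<in> hverts H \<Longrightarrow> x i \<le> x v"
  proof -
    have "Max (x ` hverts H) \<in> x ` hverts H"
      using finite_hverts assms(2) by (intro Max_in) auto
    then obtain v where "v \<in> hverts H" "x v = Max (x ` hverts H)" by auto
    then show thesis using that[of v] finite_hverts by simp
  qed
  have "x v > 0" using x vmax by (metis less_le order_antisym)
  have "edge_grad H x v \<le> (\<Sum>e\<in>{e\<in>hedges H. v \<in> e}. x v ^ (r - 1))"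
    unfolding edge_grad_def
  proof (rule sum_mono)
    fix e assume e: "e \<in> {e\<in>hedges H. v \<in> e}"
    have "(\<Prod>j\<in>e - {v}. x j) \<le> (\<Prod>j\<in>e - {v}. x v)"
      using e x vmax hedge_subset by (intro prod_mono) blast
    then show "(\<Prod>j\<in>e - {v}. x j) \<le> x v ^ (r - 1)"
      using e card_hedge finite_hedge by simp
  qed
  then have "spectral_radius r H * x v ^ (r - 1)
      \<le> real (card {e\<in>hedges H. v \<in> e}) * x v ^ (r - 1)"
    using eig[OF v] by simp
  then have "spectral_radius r H \<le> real (card {e\<in>hedges H. v \<in> e})"
    using \<open>x v > 0\<close> by simp
  then show ?thesis using that v by blast
qed

lemma hedges_two_section_nonempty:
  assumes "r \<ge> 2" and "hedges H \<noteq> {}"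
  shows "hedges (two_section H) \<noteq> {}"
proof -
  obtain e where e: "e \<in> hedges H" using assms by blast
  then have "2 \<le> card e" using card_hedge assms by simp
  then obtain u v where "u \<in> e" "v \<in> e" "u \<noteq> v"
    by (metis card_2_iff' obtain_subset_with_card_n subsetD)
  then show ?thesis using e by (auto simp: two_section_def)
qed

end

section \<open>Comparing the links with the 2-section\<close>

lemma exists_link_spectral_radius_ge:
  assumes uniform: "uniform_hypergraph r H" and r3: "r \<ge> 3" and ne: "hedges H \<noteq> {}"
  obtains u where "u \<in> hverts H" "neighbors H u \<noteq> {}"
    "spectral_radius (r - 1) (link H u) \<ge> (real r - 1) * spectral_radius_ratio r H"
proof (rule ccontr)
  assume contra: "\<not> thesis"
  note found = that
  let ?G = "two_section H"
  define c where "c = (real r - 1) * spectral_radius_ratio r H"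
  define \<rho> where "\<rho> = spectral_radius r H"
  have small: "spectral_radius (r - 1) (link H u) < c"
    if "u \<in> hverts H" "neighbors H u \<noteq> {}" for u
    using contra found[of u] that unfolding c_def by linarith
  have r2: "r \<ge> 2" using r3 by simp
  have rho: "\<rho> > 0" unfolding \<rho>_def by (rule spectral_radius_pos[OF uniform r2 ne])
  have uG: "uniform_hypergraph 2 ?G" by (rule uniform_two_section[OF uniform])
  have VG: "hverts ?G = hverts H" by (simp add: two_section_def)
  have rho2: "spectral_radius 2 ?G > 0"
    using spectral_radius_pos[OF uG] hedges_two_section_nonempty[OF uniform r2 ne] by simp
  \<comment> \<open>This identity closes the final chain: its last term equals its first, although
    one step is strict.\<close>
  have c2: "c * spectral_radius 2 ?G = (real r - 1) * \<rho>"
    using rho2 by (simp add: c_def \<rho>_def spectral_radius_ratio_def)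
  have V: "hverts H \<noteq> {}" using ne hedge_subset[OF uniform] card_hedge[OF uniform] r3 by fastforce
  obtain x :: "'a \<Rightarrow> real" where x: "\<And>i. x i \<ge> 0" and nz: "\<exists>i\<in>hverts H. x i \<noteq> 0"
    and eig': "\<And>i. i \<in> hverts H \<Longrightarrow> edge_grad H x i = spectral_radius r H * x i ^ (r - 1)"
    by (rule Perron_Frobenius[OF uniform r2 V]) (rule that)
  note eig = eig'[folded \<rho>_def]
  \<comment> \<open>The exponent \<open>r - 1\<close> fits twice: it is the power in the
    eigenequation of \<open>H\<close> and the one in the power sum for the
    \<open>(r - 1)\<close>-uniform link.\<close>
  define y where "y = (\<lambda>i. x i ^ (r - 1))"
  have y0: "y i \<ge> 0" for i using x by (simp add: y_def)
  have strict: "(real r - 1) * \<rho> * y u < c * edge_grad ?G y u"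
    if u: "u \<in> hverts H" and yu: "y u > 0" for u
  proof -
    have ul: "uniform_hypergraph (r - 1) (link H u)" by (rule uniform_link[OF uniform])
    have Vl: "hverts (link H u) = neighbors H u" by (simp add: link_def)
    have "edge_grad H x u > 0" using eig[OF u] rho yu by (simp add: y_def)
    then obtain e where e: "e \<in> hedges H" "u \<in> e"
      unfolding edge_grad_def by (metis (mono_tags, lifting) empty_Collect_eq less_irrefl sum.empty)
    \<comment> \<open>A second vertex of \<open>e\<close> gives \<open>u\<close> a neighbor, so the
      link has vertices and \<open>small\<close> applies.\<close>
    have "\<not> e \<subseteq> {u}" using card_hedge[OF uniform e(1)] r3 card_mono[of "{u}" e] by auto
    then have N: "neighbors H u \<noteq> {}" using e neighbors_iff[of _ H u] by fastforce
    have "real (r - 1) * edge_form (link H u) x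
        \<le> spectral_radius (r - 1) (link H u) * (\<Sum>v\<in>neighbors H u. x v ^ (r - 1))"
      using edge_form_le_spectral_radius[OF ul _ _ x] r3 N unfolding Vl by simp
    then have le: "(real r - 1) * \<rho> * y u
        \<le> spectral_radius (r - 1) (link H u) * edge_grad ?G y u"
      using eig[OF u] r3
      by (simp add: edge_grad_two_section y_def of_nat_diff mult.assoc
          flip: edge_grad_eq_edge_form_link)
    \<comment> \<open>Forces the neighbor sum to be positive, so that replacing the spectral radius
      of the link by \<open>c\<close> is strict.\<close>
    have "(real r - 1) * \<rho> * y u > 0" using r3 rho yu by simp
    moreover have "edge_grad ?G y u \<ge> 0"
      using y0 by (simp add: edge_grad_two_section sum_nonneg)
    ultimately have "edge_grad ?G y u > 0" using le
      by (metis less_eq_real_def mult_zero_right not_le)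
    then show ?thesis using le small[OF u N] by (smt (verit) mult_strict_right_mono)
  qed
  \<comment> \<open>Vertices with \<open>y u = 0\<close> escape \<open>strict\<close>, but after
    multiplication by \<open>y u\<close> both sides vanish there.\<close>
  have le: "y u * ((real r - 1) * \<rho> * y u) \<le> y u * (c * edge_grad ?G y u)" if "u \<in> hverts H" for u
    using strict[OF that] y0[of u] by (cases "y u = 0") auto
  obtain w where w: "w \<in> hverts H" "y w > 0"
    using nz x unfolding y_def by (metis less_eq_real_def zero_less_power)
  have "y w * ((real r - 1) * \<rho> * y w) < y w * (c * edge_grad ?G y w)"
    using mult_strict_left_mono[OF strict[OF w] w(2)] .
  then have "(\<Sum>u\<in>hverts H. y u * ((real r - 1) * \<rho> * y u))
      < (\<Sum>u\<in>hverts H. y u * (c * edge_grad ?G y u))"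
    using w(1) le by (intro sum_strict_mono_ex1[OF finite_hverts[OF uniform]]) blast+
  also have "\<dots> = c * (\<Sum>u\<in>hverts ?G. y u * edge_grad ?G y u)"
    by (simp add: VG sum_distrib_left algebra_simps)
  also have "\<dots> = c * (2 * edge_form ?G y)"
    using sum_mult_edge_grad[OF uG, of y] by simp
  also have "\<dots> \<le> c * (spectral_radius 2 ?G * (\<Sum>u\<in>hverts H. y u ^ 2))"
  proof (rule mult_left_mono)
    show "2 * edge_form ?G y \<le> spectral_radius 2 ?G * (\<Sum>u\<in>hverts H. y u ^ 2)"
      using edge_form_le_spectral_radius[OF uG _ _ y0] V unfolding VG by simp
    show "c \<ge> 0" using c2 rho2 rho r3 by (simp add: c_def \<rho>_def spectral_radius_ratio_def)
  qed
  also have "\<dots> = (real r - 1) * \<rho> * (\<Sum>u\<in>hverts H. y u ^ 2)"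
    using c2 by simp
  also have "\<dots> = (\<Sum>u\<in>hverts H. y u * ((real r - 1) * \<rho> * y u))"
    by (simp add: sum_distrib_left power2_eq_square algebra_simps)
  finally show False by simp
qed

section \<open>From the link to edges sharing two vertices\<close>

theorem theorem3p1:
  fixes r :: nat and H :: "'a hypergraph"
  assumes "r \<ge> 3"
    and "uniform_hypergraph r H"
    and "hedges H \<noteq> {}"
  shows "\<exists>u\<in>hverts H.
           spectral_radius (r - 1) (link H u) \<ge> (real r - 1) * spectral_radius_ratio r H \<and>
           (\<exists>(p::nat) (e :: nat \<Rightarrow> 'a set).
              int p = \<lceil>(real r - 1) * spectral_radius_ratio r H\<rceil> \<and>
              int p \<ge> \<lceil>real r * (real r - 1) * real (card (hedges H)) /
                       (real (card (hverts H)) * spectral_radius 2 (two_section H))\<rceil> \<and>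
              inj_on e {1..p} \<and> (\<forall>i\<in>{1..p}. e i \<in> hedges H) \<and>
              u \<in> (\<Inter>i\<in>{1..p}. e i) \<and>
              card (\<Inter>i\<in>{1..p}. e i) \<ge> 2)"
proof -
  note uniform = assms(2)
  have r2: "r \<ge> 2" using assms(1) by simp
  define c where "c = (real r - 1) * spectral_radius_ratio r H"
  have rho: "spectral_radius r H > 0" by (rule spectral_radius_pos[OF uniform r2 assms(3)])
  have rho2: "spectral_radius 2 (two_section H) > 0"
    using spectral_radius_pos[OF uniform_two_section[OF uniform]]
      hedges_two_section_nonempty[OF uniform r2 assms(3)] by simp
  have c: "c > 0" using rho rho2 r2 by (simp add: c_def spectral_radius_ratio_def)
  obtain u where u: "u \<in> hverts H" and N: "neighbors H u \<noteq> {}"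
    and uc: "spectral_radius (r - 1) (link H u) \<ge> c"
    using exists_link_spectral_radius_ge[OF uniform assms(1,3)] unfolding c_def by metis
  have "r - 1 \<ge> 2" "hverts (link H u) \<noteq> {}" using assms(1) N by (auto simp: link_def)
  then obtain v where "v \<in> hverts (link H u)"
    and "spectral_radius (r - 1) (link H u) \<le> real (card {f\<in>hedges (link H u). v \<in> f})"
    using spectral_radius_le_degree[OF uniform_link[OF uniform]] by metis
  then have v: "v \<in> neighbors H u" and
    deg: "c \<le> real (card {e\<in>hedges H. u \<in> e \<and> v \<in> e})"
    using uc edges_of_link[of v H u] by (auto simp: link_def)
  let ?D = "{e\<in>hedges H. u \<in> e \<and> v \<in> e}"
  define p where "p = nat \<lceil>c\<rceil>"
  \<comment> \<open>\<open>p \<ge> 1\<close> matters: over an empty index range the intersection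
    would be the whole type, which may be infinite and then has \<open>card\<close> 0.\<close>
  have p: "int p = \<lceil>c\<rceil>" "p \<ge> 1" using c unfolding p_def by linarith+
  have "p \<le> card ?D" unfolding p_def using deg by linarith
  then obtain D where D: "D \<subseteq> ?D" "card D = p" "finite D"
    using obtain_subset_with_card_n[of p ?D] by metis
  obtain e where e: "bij_betw e {1..p} D"
    using ex_bij_betw_nat_finite_1[OF D(3)] D(2) by blast
  then have eD: "e i \<in> ?D" if "i \<in> {1..p}" for i
    using that D(1) bij_betwE by blast
  have "(\<Inter>i\<in>{1..p}. e i) \<subseteq> e 1" using p by auto
  moreover have "finite (e 1)" using eD[of 1] p finite_hedge[OF uniform] by auto
  ultimately have "finite (\<Inter>i\<in>{1..p}. e i)" by (rule finite_subset)
  moreover have "{u, v} \<subseteq> (\<Inter>i\<in>{1..p}. e i)" using eD by auto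
  ultimately have "card {u, v} \<le> card (\<Inter>i\<in>{1..p}. e i)" by (rule card_mono)
  moreover have "card {u, v} = 2" using v by (simp add: neighbors_iff)
  ultimately have card2: "card (\<Inter>i\<in>{1..p}. e i) \<ge> 2" by simp
  have V: "real (card (hverts H)) > 0"
    using u finite_hverts[OF uniform] card_gt_0_iff by fastforce
  \<comment> \<open>The average degree bound, scaled by \<open>r - 1\<close> over the spectral
    radius of the 2-section, yields the lower bound on \<open>p\<close>.\<close>
  have "real r * real (card (hedges H)) / real (card (hverts H)) \<le> spectral_radius r H"
    using average_degree_le_spectral_radius[OF uniform r2] u V by (auto simp: pos_divide_le_eq)
  then have "(real r - 1) * (real r * real (card (hedges H)) / real (card (hverts H)) /
      spectral_radius 2 (two_section H)) \<le> c"
    unfolding c_def spectral_radius_ratio_def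
    using rho2 r2 by (intro mult_left_mono divide_right_mono) auto
  then have "real r * (real r - 1) * real (card (hedges H)) /
      (real (card (hverts H)) * spectral_radius 2 (two_section H)) \<le> c"
    by (simp add: ac_simps)
  then have "\<lceil>real r * (real r - 1) * real (card (hedges H)) /
      (real (card (hverts H)) * spectral_radius 2 (two_section H))\<rceil> \<le> int p"
    unfolding p(1) by (rule ceiling_mono)
  moreover have "inj_on e {1..p}" using e by (rule bij_betw_imp_inj_on)
  moreover have "\<forall>i\<in>{1..p}. e i \<in> hedges H" "u \<in> (\<Inter>i\<in>{1..p}. e i)" using eD by auto
  ultimately show ?thesis
    using u uc p(1) card2 unfolding c_def by blast
qed

end
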